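(* Every $CT_4$-space is countably compact.
   Context: All topological spaces are assumed to be $T_1$ and non-empty. For a space $X$, $\mathrm{Cld}(X)$ denotes the set of all non-empty closed subsets of $X$, endowed with the Vietoris topology, i.e. the topology having as a subbase all sets $U^-=\{F\in\mathrm{Cld}(X): F\cap U\neq\emptyset\}$ and $U^+=\{F\in\mathrm{Cld}(X): F\subseteq U\}$ with $U$ open in $X$. Let $\mathcal{T}_4(X)=\{(F_1,F_2)\in\mathrm{Cld}(X)^2: F_1\cap F_2=\emptyset\}$, with the subspace topology from the product space $\mathrm{Cld}(X)^2$. The space $X$ is called $CT_4$ if there is a continuous map $\phi=(\phi_1,\phi_2):\mathcal{T}_4(X)\to\mathrm{Cld}(X)^2$ such that for every $(F_1,F_2)\in\mathcal{T}_4(X)$: $\phi_1(F_1,F_2)\cup\phi_2(F_1,F_2)=X$ and $F_j\cap\phi_j(F_1,F_2)=\emptyset$ for $j=1,2$. A $T_2$-space is countably compact if each countable open cover has a finite subcover. *)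

theory Defs
  imports "HOL-Analysis.Analysis"
begin

definition Cld :: "'a topology \<Rightarrow> 'a set set" where
  "Cld X = {F. closedin X F \<and> F \<noteq> {}}"

definition vietoris_minus :: "'a topology \<Rightarrow> 'a set \<Rightarrow> 'a set set" where
  "vietoris_minus X U = {F \<in> Cld X. F \<inter> U \<noteq> {}}"

definition vietoris_plus :: "'a topology \<Rightarrow> 'a set \<Rightarrow> 'a set set" where
  "vietoris_plus X U = {F \<in> Cld X. F \<subseteq> U}"

definition vietoris_topology :: "'a topology \<Rightarrow> 'a set topology" where
  "vietoris_topology X = topology_generated_by
     ({vietoris_minus X U | U. openin X U} \<union> {vietoris_plus X U | U. openin X U})"

lemma topspace_vietoris_topology: "topspace (vietoris_topology X) = Cld X"
proof
  show "topspace (vietoris_topology X) \<subseteq> Cld X"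
    by (auto simp: vietoris_topology_def vietoris_minus_def vietoris_plus_def)
next
  have "vietoris_plus X (topspace X) = Cld X"
    by (auto simp: vietoris_plus_def Cld_def dest: closedin_subset)
  then show "Cld X \<subseteq> topspace (vietoris_topology X)"
    unfolding vietoris_topology_def topology_generated_by_topspace
    using openin_topspace[of X] by blast
qed

definition disjoint_closed_pairs :: "'a topology \<Rightarrow> ('a set \<times> 'a set) set" where
  "disjoint_closed_pairs X = {(F1, F2). F1 \<in> Cld X \<and> F2 \<in> Cld X \<and> F1 \<inter> F2 = {}}"

definition T4_pairs_topology :: "'a topology \<Rightarrow> ('a set \<times> 'a set) topology" where
  "T4_pairs_topology X =
     subtopology (prod_topology (vietoris_topology X) (vietoris_topology X)) (disjoint_closed_pairs X)"

(* The standing assumptions (T1 and non-empty) are not part of this predicate;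
   they are separate hypotheses wherever it is used. *)
definition CT4_space :: "'a topology \<Rightarrow> bool" where
  "CT4_space X \<longleftrightarrow>
     (\<exists>\<phi>. continuous_map (T4_pairs_topology X)
             (prod_topology (vietoris_topology X) (vietoris_topology X)) \<phi> \<and>
          (\<forall>(F1, F2) \<in> disjoint_closed_pairs X.
             fst (\<phi> (F1, F2)) \<union> snd (\<phi> (F1, F2)) = topspace X \<and>
             F1 \<inter> fst (\<phi> (F1, F2)) = {} \<and>
             F2 \<inter> snd (\<phi> (F1, F2)) = {}))"

(* Countable compactness is by convention a property of Hausdorff spaces here.
   The library's countably_compact concerns sets in a type-class topology, without separation. *)
definition countably_compact_space :: "'a topology \<Rightarrow> bool" where
  "countably_compact_space X \<longleftrightarrow>
     Hausdorff_space X \<and>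
     (\<forall>\<U>. countable \<U> \<and> (\<forall>U\<in>\<U>. openin X U) \<and> \<Union>\<U> = topspace X \<longrightarrow>
          (\<exists>\<F>. finite \<F> \<and> \<F> \<subseteq> \<U> \<and> \<Union>\<F> = topspace X))"

end

theory Submission
  imports Defs
begin

text \<open>
  A \<open>CT4\<close> selection gives, for disjoint non-empty closed sets, disjoint open neighbourhoods (the
  complements of its two values); applied to singletons this makes a \<open>T1\<close> space Hausdorff.

  Suppose now that some countable open cover has no finite subcover. Choosing points outside longer
  and longer finite unions of the cover yields a countably infinite set \<open>D\<close> all of whose subsets
  are closed (lemma \<open>infinite_hereditarily_closed_set\<close>). Let \<open>A\<close> be a non-empty proper subset of
  \<open>D\<close>, and let \<open>(\<phi>\<^sub>1, \<phi>\<^sub>2)\<close> be a selection. As \<open>\<phi>\<^sub>1(A, D - A)\<close> misses \<open>A\<close> and \<open>\<phi>\<^sub>2(A, D - A)\<close> misses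
  \<open>D - A\<close>, continuity keeps this true for all pairs close to \<open>(A, D - A)\<close>. Finite sets are dense
  in the Vietoris topology, in the sense that every neighbourhood of a non-empty closed set contains
  a non-empty finite subset of it (lemma \<open>vietoris_finite_approximation\<close>). So there are finite \<open>K \<subseteq> A\<close> and
  \<open>L \<subseteq> D - A\<close> such that \<open>\<phi>\<^sub>1(K, L)\<close> misses \<open>A\<close> and \<open>\<phi>\<^sub>2(K, L)\<close> misses \<open>D - A\<close>; since the two
  values cover the space, \<open>A\<close> is recovered from the pair \<open>(K, L)\<close> as \<open>D - \<phi>\<^sub>1(K, L)\<close>.
  But there are only countably many such pairs, and uncountably many such \<open>A\<close>.
\<close>

lemma uncountable_Pow_infinite:
  assumes "infinite D"
  shows "uncountable (Pow D)"
proof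
  assume "countable (Pow D)"
  moreover obtain f :: "nat \<Rightarrow> 'a" where f: "inj f" "range f \<subseteq> D"
    using assms infinite_countable_subset by blast
  ultimately have "countable (Pow (range f))"
    by (meson Pow_mono countable_subset)
  then have "countable (range (\<lambda>S. f ` S))"
    by (rule countable_subset[rotated]) auto
  moreover have "inj (\<lambda>S. f ` S)"
    using f(1) by (simp add: inj_on_def inj_image_eq_iff)
  ultimately have "countable (UNIV :: nat set set)"
    by (rule countable_image_inj_on)
  then obtain g :: "nat \<Rightarrow> nat set" where "range g = UNIV"
    by (metis UNIV_not_empty range_from_nat_into)
  then show False
    using Cantors_theorem by (metis Pow_UNIV)
qed

text \<open>
  Stronger than density of the finite sets: for the induction over the generated topology, all
  closed sets between the finite set and \<open>F\<close> must be in the given neighbourhood.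
\<close>

lemma vietoris_finite_core:
  assumes "openin (vietoris_topology X) W" "F \<in> W"
  shows "\<exists>K. finite K \<and> K \<subseteq> F \<and> (\<forall>G\<in>Cld X. K \<subseteq> G \<and> G \<subseteq> F \<longrightarrow> G \<in> W)"
proof -
  let ?B = "{vietoris_minus X U | U. openin X U} \<union> {vietoris_plus X U | U. openin X U}"
  have "generate_topology_on ?B W"
    using assms(1) by (simp add: vietoris_topology_def openin_topology_generated_by_iff)
  then show ?thesis
    using assms(2)
  proof (induction arbitrary: F)
    case Empty
    then show ?case by simp
  next
    case (Int V W)
    from Int.prems Int.IH(1)[of F] obtain K where
      "finite K" "K \<subseteq> F" "\<forall>G\<in>Cld X. K \<subseteq> G \<and> G \<subseteq> F \<longrightarrow> G \<in> V" by blast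
    moreover from Int.prems Int.IH(2)[of F] obtain L where
      "finite L" "L \<subseteq> F" "\<forall>G\<in>Cld X. L \<subseteq> G \<and> G \<subseteq> F \<longrightarrow> G \<in> W" by blast
    ultimately show ?case
      by (intro exI[of _ "K \<union> L"]) auto
  next
    case (UN \<W>)
    then obtain W where "W \<in> \<W>" "F \<in> W" by blast
    with UN.IH show ?case by (meson UnionI)
  next
    case (Basis W)
    then consider U where "W = vietoris_minus X U" | U where "W = vietoris_plus X U"
      by blast
    then show ?case
    proof cases
      case 1
      with Basis.prems obtain x where "x \<in> F" "x \<in> U"
        by (auto simp: vietoris_minus_def)
      with 1 show ?thesis
        by (intro exI[of _ "{x}"]) (auto simp: vietoris_minus_def)
    next
      case 2
      with Basis.prems show ?thesis
        by (intro exI[of _ "{}"]) (auto simp: vietoris_plus_def)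
    qed
  qed
qed

lemma vietoris_finite_approximation:
  assumes "t1_space X" "openin (vietoris_topology X) W" "F \<in> W"
  obtains K where "finite K" "K \<subseteq> F" "K \<in> Cld X" "K \<in> W"
proof -
  have F: "F \<in> Cld X"
    using assms(2,3) openin_subset topspace_vietoris_topology by blast
  then obtain x where x: "x \<in> F" "F \<subseteq> topspace X"
    by (auto simp: Cld_def dest: closedin_subset)
  obtain K where K: "finite K" "K \<subseteq> F" "\<forall>G\<in>Cld X. K \<subseteq> G \<and> G \<subseteq> F \<longrightarrow> G \<in> W"
    using vietoris_finite_core[OF assms(2,3)] by blast
  \<comment> \<open>The point \<open>x\<close> is added because \<open>K\<close> may be empty.\<close>
  have "insert x K \<in> Cld X"
    using assms(1) K x unfolding Cld_def t1_space_closedin_finite by auto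
  with K x show ?thesis
    by (intro that[of "insert x K"]) auto
qed

text \<open>
  The set \<open>D\<close> meets every member of the cover in a finite set, so no subset of \<open>D\<close> has an
  accumulation point. It is infinite because a finite set is covered by finitely many members.
\<close>

lemma infinite_hereditarily_closed_set:
  assumes X: "t1_space X"
    and \<U>: "countable \<U>" "\<And>U. U \<in> \<U> \<Longrightarrow> openin X U" "\<Union>\<U> = topspace X"
    and no_subcover: "\<And>\<F>. finite \<F> \<Longrightarrow> \<F> \<subseteq> \<U> \<Longrightarrow> \<Union>\<F> \<noteq> topspace X"
  obtains D where "countable D" "infinite D" "\<And>S. S \<subseteq> D \<Longrightarrow> closedin X S"
proof -
  have ne: "\<U> \<noteq> {}"
    using no_subcover[of "{}"] \<U>(3) by auto
  define U where "U = from_nat_into \<U>"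
  have U: "range U = \<U>"
    unfolding U_def using ne \<U>(1) by (rule range_from_nat_into)
  have "\<exists>x. x \<in> topspace X \<and> x \<notin> (\<Union>i\<le>n. U i)" for n
  proof -
    have "(\<Union>i\<le>n. U i) \<noteq> topspace X" "(\<Union>i\<le>n. U i) \<subseteq> topspace X"
      using no_subcover[of "U ` {..n}"] U \<U>(3) by auto
    then show ?thesis by blast
  qed
  then obtain d where d: "d n \<in> topspace X" "d n \<notin> (\<Union>i\<le>n. U i)" for n
    by metis
  have fin: "finite (range d \<inter> U m)" for m
  proof -
    have "range d \<inter> U m \<subseteq> d ` {..<m}"
      using d(2) by (force simp: not_less)
    then show ?thesis
      using finite_subset by blast
  qed
  show ?thesis
  proof
    show "countable (range d)" by simp
    show "infinite (range d)"
    proof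
      assume "finite (range d)"
      moreover have "range d \<subseteq> \<Union>(range U)"
        using d(1) U \<U>(3) by auto
      ultimately obtain I where I: "finite I" "range d \<subseteq> (\<Union>i\<in>I. U i)"
        by (metis finite_subset_Union finite_subset_image image_mono)
      then obtain n where "I \<subseteq> {..n}"
        using finite_nat_iff_bounded_le by blast
      with I(2) have "d n \<in> (\<Union>i\<le>n. U i)"
        by blast
      with d(2) show False by blast
    qed
    show "closedin X S" if S: "S \<subseteq> range d" for S
    proof -
      have "topspace X - S = (\<Union>m. U m - S \<inter> U m)"
        using U \<U>(3) by blast
      moreover have "openin X (U m - S \<inter> U m)" for m
      proof (rule openin_diff)
        show "openin X (U m)"
          using U \<U>(2) by blast
        have "finite (S \<inter> U m)"
          using fin[of m] by (rule finite_subset[rotated]) (use S in blast)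
        moreover have "S \<inter> U m \<subseteq> topspace X"
          using S d(1) by blast
        ultimately show "closedin X (S \<inter> U m)"
          using X t1_space_closedin_finite by blast
      qed
      ultimately have "openin X (topspace X - S)"
        by auto
      then show ?thesis
        using S d(1) by (auto simp: closedin_def)
    qed
  qed
qed

lemma CT4_spaceE:
  assumes "CT4_space X"
  obtains \<phi>1 \<phi>2 where
    "continuous_map (T4_pairs_topology X) (vietoris_topology X) \<phi>1"
    "continuous_map (T4_pairs_topology X) (vietoris_topology X) \<phi>2"
    "\<And>A B. A \<in> Cld X \<Longrightarrow> B \<in> Cld X \<Longrightarrow> A \<inter> B = {} \<Longrightarrow>
       \<phi>1 (A, B) \<in> Cld X \<and> \<phi>2 (A, B) \<in> Cld X \<and> \<phi>1 (A, B) \<union> \<phi>2 (A, B) = topspace X \<and>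
       A \<inter> \<phi>1 (A, B) = {} \<and> B \<inter> \<phi>2 (A, B) = {}"
proof -
  obtain \<phi> where \<phi>: "continuous_map (T4_pairs_topology X)
      (prod_topology (vietoris_topology X) (vietoris_topology X)) \<phi>"
    "\<forall>(F1, F2) \<in> disjoint_closed_pairs X.
       fst (\<phi> (F1, F2)) \<union> snd (\<phi> (F1, F2)) = topspace X \<and>
       F1 \<inter> fst (\<phi> (F1, F2)) = {} \<and> F2 \<inter> snd (\<phi> (F1, F2)) = {}"
    using assms unfolding CT4_space_def by blast
  have top: "topspace (T4_pairs_topology X) = disjoint_closed_pairs X"
    by (auto simp: T4_pairs_topology_def topspace_vietoris_topology disjoint_closed_pairs_def)
  have c: "continuous_map (T4_pairs_topology X) (vietoris_topology X) (fst \<circ> \<phi>)"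
    "continuous_map (T4_pairs_topology X) (vietoris_topology X) (snd \<circ> \<phi>)"
    using \<phi>(1) by (simp_all add: continuous_map_pairwise)
  show ?thesis
  proof (rule that[OF c])
    fix A B assume "A \<in> Cld X" "B \<in> Cld X" "A \<inter> B = {}"
    then have AB: "(A, B) \<in> disjoint_closed_pairs X"
      by (simp add: disjoint_closed_pairs_def)
    then have "(fst \<circ> \<phi>) (A, B) \<in> Cld X" "(snd \<circ> \<phi>) (A, B) \<in> Cld X"
      using c top by (auto simp: continuous_map_def topspace_vietoris_topology Pi_iff)
    with AB \<phi>(2) show "(fst \<circ> \<phi>) (A, B) \<in> Cld X \<and> (snd \<circ> \<phi>) (A, B) \<in> Cld X \<and>
        (fst \<circ> \<phi>) (A, B) \<union> (snd \<circ> \<phi>) (A, B) = topspace X \<and>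
        A \<inter> (fst \<circ> \<phi>) (A, B) = {} \<and> B \<inter> (snd \<circ> \<phi>) (A, B) = {}"
      by auto
  qed
qed

lemma CT4_imp_Hausdorff_space:
  assumes "t1_space X" "CT4_space X"
  shows "Hausdorff_space X"
  unfolding Hausdorff_space_def disjnt_def
proof (intro allI impI)
  fix x y assume xy: "x \<in> topspace X \<and> y \<in> topspace X \<and> x \<noteq> y"
  obtain \<phi>1 \<phi>2 where
    "continuous_map (T4_pairs_topology X) (vietoris_topology X) \<phi>1"
    "continuous_map (T4_pairs_topology X) (vietoris_topology X) \<phi>2"
    and \<phi>: "\<And>A B. A \<in> Cld X \<Longrightarrow> B \<in> Cld X \<Longrightarrow> A \<inter> B = {} \<Longrightarrow>
       \<phi>1 (A, B) \<in> Cld X \<and> \<phi>2 (A, B) \<in> Cld X \<and> \<phi>1 (A, B) \<union> \<phi>2 (A, B) = topspace X \<and>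
       A \<inter> \<phi>1 (A, B) = {} \<and> B \<inter> \<phi>2 (A, B) = {}"
    by (rule CT4_spaceE[OF assms(2)]) blast
  have "{x} \<in> Cld X" "{y} \<in> Cld X"
    using assms(1) xy by (auto simp: Cld_def closedin_t1_singleton)
  with xy \<phi>[of "{x}" "{y}"] show "\<exists>U V. openin X U \<and> openin X V \<and> x \<in> U \<and> y \<in> V \<and> U \<inter> V = {}"
    by (intro exI[of _ "topspace X - \<phi>1 ({x}, {y})"] exI[of _ "topspace X - \<phi>2 ({x}, {y})"])
      (auto simp: Cld_def)
qed

theorem theorem4p1:
  fixes X :: "'a topology"
  assumes "t1_space X"
    and "topspace X \<noteq> {}"
    and "CT4_space X"
  shows "countably_compact_space X"
  unfolding countably_compact_space_def
proof (intro conjI allI impI)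
  show "Hausdorff_space X"
    using assms(1,3) by (rule CT4_imp_Hausdorff_space)
  fix \<U> assume cover: "countable \<U> \<and> (\<forall>U\<in>\<U>. openin X U) \<and> \<Union>\<U> = topspace X"
  show "\<exists>\<F>. finite \<F> \<and> \<F> \<subseteq> \<U> \<and> \<Union>\<F> = topspace X"
  proof (rule ccontr)
    assume neg: "\<not> ?thesis"
    have \<U>: "countable \<U>" "\<And>U. U \<in> \<U> \<Longrightarrow> openin X U" "\<Union>\<U> = topspace X"
      using cover by simp_all
    have no_subcover: "\<Union>\<F> \<noteq> topspace X" if "finite \<F>" "\<F> \<subseteq> \<U>" for \<F>
      using neg that by blast
    obtain D where D: "countable D" "infinite D" and closed: "\<And>S. S \<subseteq> D \<Longrightarrow> closedin X S"
      using infinite_hereditarily_closed_set[OF assms(1) \<U> no_subcover] by metis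
    obtain \<phi>1 \<phi>2 where
      cont: "continuous_map (T4_pairs_topology X) (vietoris_topology X) \<phi>1"
        "continuous_map (T4_pairs_topology X) (vietoris_topology X) \<phi>2"
      and \<phi>: "\<And>A B. A \<in> Cld X \<Longrightarrow> B \<in> Cld X \<Longrightarrow> A \<inter> B = {} \<Longrightarrow>
         \<phi>1 (A, B) \<in> Cld X \<and> \<phi>2 (A, B) \<in> Cld X \<and> \<phi>1 (A, B) \<union> \<phi>2 (A, B) = topspace X \<and>
         A \<inter> \<phi>1 (A, B) = {} \<and> B \<inter> \<phi>2 (A, B) = {}"
      by (rule CT4_spaceE[OF assms(3)]) blast
    let ?T = "T4_pairs_topology X" and ?V = "vietoris_topology X"
    let ?P = "{K. finite K \<and> K \<subseteq> D} \<times> {L. finite L \<and> L \<subseteq> D}"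
    have coded: "\<exists>p\<in>?P. A = D - \<phi>1 p" if A: "A \<subseteq> D" "A \<noteq> {}" "A \<noteq> D" for A
    proof -
      define B where "B = D - A"
      have AB: "A \<in> Cld X" "B \<in> Cld X" "A \<inter> B = {}"
        using A closed by (auto simp: Cld_def B_def)
      have plus: "openin ?V (vietoris_plus X (topspace X - S))" if "closedin X S" for S
        unfolding vietoris_topology_def using that
        by (intro topology_generated_by_Basis) blast
      \<comment> \<open>Near \<open>(A, B)\<close> the two values still miss the sets \<open>A\<close> and \<open>B\<close>, not only the moving pair.\<close>
      define W where "W = {p \<in> topspace ?T. \<phi>1 p \<in> vietoris_plus X (topspace X - A)} \<inter>
        {p \<in> topspace ?T. \<phi>2 p \<in> vietoris_plus X (topspace X - B)}"
      have "openin ?T W"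
        unfolding W_def using AB plus cont
        by (intro openin_Int openin_continuous_map_preimage) (auto simp: Cld_def)
      then obtain W' where W': "openin (prod_topology ?V ?V) W'"
        "W = W' \<inter> disjoint_closed_pairs X"
        unfolding T4_pairs_topology_def openin_subtopology by blast
      have "(A, B) \<in> W"
        using AB \<phi>[OF AB]
        by (auto simp: W_def T4_pairs_topology_def topspace_vietoris_topology
            disjoint_closed_pairs_def vietoris_plus_def)
      then obtain N1 N2 where N: "openin ?V N1" "A \<in> N1" "openin ?V N2" "B \<in> N2" "N1 \<times> N2 \<subseteq> W'"
        using W' unfolding openin_prod_topology_alt by (metis IntD1)
      obtain K where K: "finite K" "K \<subseteq> A" "K \<in> Cld X" "K \<in> N1"
        using vietoris_finite_approximation[OF assms(1) N(1,2)] by blast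
      obtain L where L: "finite L" "L \<subseteq> B" "L \<in> Cld X" "L \<in> N2"
        using vietoris_finite_approximation[OF assms(1) N(3,4)] by blast
      have KL: "K \<inter> L = {}"
        using K L AB by blast
      then have "(K, L) \<in> W"
        using K L N W' by (auto simp: disjoint_closed_pairs_def)
      then have "\<phi>1 (K, L) \<inter> A = {}" "\<phi>2 (K, L) \<inter> B = {}"
        by (auto simp: W_def vietoris_plus_def)
      moreover have "\<phi>1 (K, L) \<union> \<phi>2 (K, L) = topspace X"
        using \<phi> K(3) L(3) KL by blast
      moreover have "D \<subseteq> topspace X"
        using closed closedin_subset by blast
      ultimately have "A = D - \<phi>1 (K, L)"
        using A unfolding B_def by blast
      moreover have "(K, L) \<in> ?P"
        using K L A unfolding B_def by blast
      ultimately show ?thesis by blast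
    qed
    have "countable ?P"
      using D(1) by (intro countable_SIGMA countable_Collect_finite_subset)
    then have "countable ((\<lambda>p. D - \<phi>1 p) ` ?P \<union> {{}, D})"
      by simp
    moreover have "Pow D \<subseteq> (\<lambda>p. D - \<phi>1 p) ` ?P \<union> {{}, D}"
      using coded by blast
    ultimately have "countable (Pow D)"
      by (rule countable_subset[rotated])
    with uncountable_Pow_infinite[OF D(2)] show False by blast
  qed
qed

end
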